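(* Let $d_s\ge 1$ and $K\ge 1$ be integers, let $z_s\sim\mathcal N(0,I)$ be a standard Gaussian random vector on $\mathbb R^{d_s}$, and let $\{A_k\}_{k=1}^K$ be any measurable partition of $\mathbb R^{d_s}$ with $P(z_s\in A_k)=1/K$ for each $k$. Define the label $y\in\{1,\dots,K\}$ by $y=k\iff z_s\in A_k$. Let $q(z_s)$ denote the marginal law of $z_s$ under the joint law of $(z_s,y)$. Then $q(z_s)=\mathcal N(0,I)$ exactly, so $D(q(z_s),\mathcal N(0,I))=0$ for every divergence $D$; and $I(z_s;y)=H(y)=\log K$, which is the maximum possible value of the mutual information between a random variable and a label taking values in $\{1,\dots,K\}$.
   Context: A divergence $D$ is a function of pairs of probability measures on $\mathbb R^{d_s}$ with values in $[0,\infty]$ such that $D(P,P)=0$ for every $P$. $H(y)$ denotes Shannon entropy (natural logarithm) and $I(z_s;y)$ denotes mutual information, i.e. the Kullback–Leibler divergence of the joint law of $(z_s,y)$ from the product of its marginals. *)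

theory Defs
  imports "HOL-Probability.Probability"
begin

definition std_gaussian :: "(real ^ 'n::finite) measure" where
  "std_gaussian = density lborel
     (\<lambda>x. ennreal ((2 * pi) powr (- real CARD('n) / 2) * exp (- (norm x)\<^sup>2 / 2)))"

definition divergence ::
  "((real ^ 'n::finite) measure \<Rightarrow> (real ^ 'n) measure \<Rightarrow> ennreal) \<Rightarrow> bool" where
  "divergence D \<longleftrightarrow> (\<forall>P. prob_space P \<and> sets P = sets borel \<longrightarrow> D P P = 0)"

definition joint_law ::
  "'w measure \<Rightarrow> 'a measure \<Rightarrow> 'b measure \<Rightarrow> ('w \<Rightarrow> 'a) \<Rightarrow> ('w \<Rightarrow> 'b) \<Rightarrow> ('a \<times> 'b) measure" where
  "joint_law M S T X Y = distr M (S \<Otimes>\<^sub>M T) (\<lambda>w. (X w, Y w))"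

(* The library's mutual information is a Bochner integral and hence always a real number, with
   a meaningless value where the Kullback-Leibler divergence is infinite. Here the value is
   infinity unless the joint law has a density with respect to the product of the marginals whose
   logarithm is integrable under the joint law; the negative part of that logarithm is always
   integrable. The base exp 1 makes the logarithm natural. *)
definition mutual_info ::
  "'w measure \<Rightarrow> 'a measure \<Rightarrow> 'b measure \<Rightarrow> ('w \<Rightarrow> 'a) \<Rightarrow> ('w \<Rightarrow> 'b) \<Rightarrow> ereal" where
  "mutual_info M S T X Y =
    (let J = joint_law M S T X Y;
         Q = distr M S X \<Otimes>\<^sub>M distr M T Y
     in if absolutely_continuous Q J \<and> integrable J (entropy_density (exp 1) Q J)
        then ereal (prob_space.mutual_information M (exp 1) S T X Y)
        else \<infinity>)"

definition shannon_entropy :: "'w measure \<Rightarrow> 'b measure \<Rightarrow> ('w \<Rightarrow> 'b) \<Rightarrow> real" where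
  "shannon_entropy M T Y = prob_space.entropy M (exp 1) T Y"

end

theory Submission
  imports Defs
begin

text \<open>
  Let \<open>J\<close> be the joint law of \<open>X\<close> and a label \<open>Y\<close> in a set of \<open>K\<close> elements, \<open>Q\<close> the product of the
  marginals and \<open>p\<close> the mass function of \<open>Y\<close>. Since \<open>J(E \<times> {k}) \<le> P(X \<in> E)\<close>, the density
  \<open>f = dJ/dQ\<close> exists and is dominated by \<open>1 / p(k)\<close>. Hence
  \<open>\<integral> f dJ \<le> \<integral> 1 / p(Y) dP \<le> K\<close>, and integrating the tangent line bound
  \<open>ln f \<le> ln K - 1 + f / K\<close> against \<open>J\<close> gives \<open>I(X;Y) \<le> ln K\<close>; integrability of \<open>ln f\<close> follows from
  \<open>\<bar>ln f\<bar> \<le> f + 1/f\<close> and \<open>\<integral> 1/f dJ \<le> 1\<close>. If \<open>Y\<close> is uniform and a function of \<open>X\<close>, the density is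
  \<open>K\<close> times the indicator of the graph, so \<open>ln f = ln K\<close> almost surely.
\<close>

section \<open>Integration against finite labels and the joint law\<close>

lemma ennreal_one_divide_mult_self: "a \<noteq> 0 \<Longrightarrow> a \<noteq> \<infinity> \<Longrightarrow> 1 / a * a = (1 :: ennreal)"
  by (subst ennreal_divide_times) (simp add: less_top)

lemma nn_integral_comp_finite_label:
  assumes Y[measurable]: "Y \<in> M \<rightarrow>\<^sub>M count_space T" and T: "finite T"
  shows "(\<integral>\<^sup>+ w. h (Y w) \<partial>M) = (\<Sum>k\<in>T. h k * emeasure M {w \<in> space M. Y w = k})"
proof -
  have "(\<integral>\<^sup>+ w. h (Y w) \<partial>M)
      = (\<integral>\<^sup>+ w. (\<Sum>k\<in>T. h k * indicator {w \<in> space M. Y w = k} w) \<partial>M)"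
  proof (rule nn_integral_cong)
    fix w assume w: "w \<in> space M"
    then have "Y w \<in> T"
      using measurable_space[OF Y] by simp
    have "(\<Sum>k\<in>T. h k * indicator {w \<in> space M. Y w = k} w) = (\<Sum>k\<in>T. if Y w = k then h k else 0)"
      using w by (intro sum.cong) (auto simp: indicator_def)
    then show "h (Y w) = (\<Sum>k\<in>T. h k * indicator {w \<in> space M. Y w = k} w)"
      using T \<open>Y w \<in> T\<close> by (simp add: sum.delta)
  qed
  also have "\<dots> = (\<Sum>k\<in>T. h k * emeasure M {w \<in> space M. Y w = k})"
    by (simp add: nn_integral_sum nn_integral_cmult)
  finally show ?thesis .
qed

text \<open>Tonelli with the label as the outer variable: the outer integral then collapses to a
  finite sum, and only the inner one has to be pulled back along \<open>X\<close>.\<close>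

lemma (in prob_space) nn_integral_product_marginals:
  assumes X[measurable]: "X \<in> M \<rightarrow>\<^sub>M S" and Y[measurable]: "Y \<in> M \<rightarrow>\<^sub>M count_space T"
    and T: "finite T" and f[measurable]: "f \<in> borel_measurable (S \<Otimes>\<^sub>M count_space T)"
  shows "(\<integral>\<^sup>+ p. f p \<partial>(distr M S X \<Otimes>\<^sub>M distr M (count_space T) Y))
       = (\<Sum>k\<in>T. (\<integral>\<^sup>+ w. f (X w, k) \<partial>M) * emeasure M {w \<in> space M. Y w = k})"
proof -
  interpret X: prob_space "distr M S X" by (rule prob_space_distr) fact
  interpret Y: prob_space "distr M (count_space T) Y" by (rule prob_space_distr) fact
  interpret P: pair_sigma_finite "distr M S X" "distr M (count_space T) Y" ..
  have "(\<integral>\<^sup>+ p. f p \<partial>(distr M S X \<Otimes>\<^sub>M distr M (count_space T) Y))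
      = (\<integral>\<^sup>+ k. (\<integral>\<^sup>+ x. f (x, k) \<partial>distr M S X) \<partial>distr M (count_space T) Y)"
    by (rule P.nn_integral_snd[symmetric]) simp
  also have "\<dots> = (\<integral>\<^sup>+ w. (\<integral>\<^sup>+ x. f (x, Y w) \<partial>distr M S X) \<partial>M)"
    by (rule nn_integral_distr) auto
  also have "\<dots> = (\<Sum>k\<in>T. (\<integral>\<^sup>+ x. f (x, k) \<partial>distr M S X) * emeasure M {w \<in> space M. Y w = k})"
    by (rule nn_integral_comp_finite_label[OF Y T])
  also have "\<dots> = (\<Sum>k\<in>T. (\<integral>\<^sup>+ w. f (X w, k) \<partial>M) * emeasure M {w \<in> space M. Y w = k})"
    by (intro sum.cong refl arg_cong2[where f="(*)"] nn_integral_distr) auto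
  finally show ?thesis .
qed

text \<open>The event splits into disjoint pieces, one per label. Fixing \<open>k\<close> inside
  \<open>(X w, k)\<close> gives summands that can be compared term by term with those of
  \<open>nn_integral_product_marginals\<close>.\<close>

lemma (in prob_space) emeasure_joint_law:
  assumes X[measurable]: "X \<in> M \<rightarrow>\<^sub>M S" and Y[measurable]: "Y \<in> M \<rightarrow>\<^sub>M count_space T"
    and T: "finite T" and E[measurable]: "E \<in> sets (S \<Otimes>\<^sub>M count_space T)"
  shows "emeasure (joint_law M S (count_space T) X Y) E
       = (\<Sum>k\<in>T. emeasure M {w \<in> space M. (X w, k) \<in> E \<and> Y w = k})"
proof -
  have "emeasure (joint_law M S (count_space T) X Y) E = emeasure M {w \<in> space M. (X w, Y w) \<in> E}"
    by (auto simp: joint_law_def emeasure_distr intro!: arg_cong[where f="emeasure M"])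
  also have "{w \<in> space M. (X w, Y w) \<in> E} = (\<Union>k\<in>T. {w \<in> space M. (X w, k) \<in> E \<and> Y w = k})"
    using measurable_space[OF Y] by auto
  also have "emeasure M \<dots> = (\<Sum>k\<in>T. emeasure M {w \<in> space M. (X w, k) \<in> E \<and> Y w = k})"
    using T by (intro sum_emeasure[symmetric]) (auto simp: disjoint_family_on_def)
  finally show ?thesis .
qed

text \<open>For a label of probability zero the density below is \<open>1 / 0 = \<infinity>\<close>, which is harmless
  because such a label has zero mass under the product of the marginals.\<close>

lemma (in prob_space) joint_law_le_density:
  assumes X[measurable]: "X \<in> M \<rightarrow>\<^sub>M S" and Y[measurable]: "Y \<in> M \<rightarrow>\<^sub>M count_space T"
    and T: "finite T"
  shows "joint_law M S (count_space T) X Y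
      \<le> density (distr M S X \<Otimes>\<^sub>M distr M (count_space T) Y)
          (\<lambda>p. 1 / emeasure M {w \<in> space M. Y w = snd p})" (is "?J \<le> ?D")
proof -
  have sets: "sets ?J = sets ?D"
    by (auto simp: joint_law_def intro!: sets_pair_measure_cong)
  have [measurable]: "(\<lambda>p. 1 / emeasure M {w \<in> space M. Y w = snd p})
      \<in> borel_measurable (S \<Otimes>\<^sub>M count_space T)"
    by (rule measurable_compose[OF measurable_snd]) simp
  have "emeasure ?J E \<le> emeasure ?D E" if "E \<in> sets ?J" for E
  proof -
    have E[measurable]: "E \<in> sets (S \<Otimes>\<^sub>M count_space T)"
      using that by (simp add: joint_law_def)
    let ?m = "\<lambda>k. emeasure M {w \<in> space M. Y w = k}"
    have "emeasure ?J E = (\<Sum>k\<in>T. emeasure M {w \<in> space M. (X w, k) \<in> E \<and> Y w = k})"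
      by (rule emeasure_joint_law) fact+
    \<comment> \<open>For a label of positive mass the factors \<open>1 / ?m k\<close> and
      \<open>?m k\<close> cancel, leaving the probability of the slice of \<open>E\<close> at
      \<open>k\<close>, from which the left side only drops the condition
      \<open>Y w = k\<close>.\<close>
    also have "\<dots> \<le> (\<Sum>k\<in>T. (\<integral>\<^sup>+ w. 1 / ?m k * indicator E (X w, k) \<partial>M) * ?m k)"
    proof (rule sum_mono)
      fix k assume "k \<in> T"
      let ?E = "{w \<in> space M. (X w, k) \<in> E}"
      have [measurable]: "?E \<in> sets M"
        using \<open>k \<in> T\<close> by simp
      have "(\<integral>\<^sup>+ w. 1 / ?m k * indicator E (X w, k) \<partial>M) = (\<integral>\<^sup>+ w. 1 / ?m k * indicator ?E w \<partial>M)"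
        by (intro nn_integral_cong) (auto simp: indicator_def)
      also have "\<dots> = 1 / ?m k * emeasure M ?E"
        by (simp add: nn_integral_cmult)
      finally have *: "(\<integral>\<^sup>+ w. 1 / ?m k * indicator E (X w, k) \<partial>M) = 1 / ?m k * emeasure M ?E" .
      show "emeasure M {w \<in> space M. (X w, k) \<in> E \<and> Y w = k}
          \<le> (\<integral>\<^sup>+ w. 1 / ?m k * indicator E (X w, k) \<partial>M) * ?m k"
      proof (cases "?m k = 0")
        case True
        have "emeasure M {w \<in> space M. (X w, k) \<in> E \<and> Y w = k} \<le> ?m k"
          by (intro emeasure_mono) auto
        with True show ?thesis by simp
      next
        case False
        have "1 / ?m k * emeasure M ?E * ?m k = 1 / ?m k * ?m k * emeasure M ?E"
          by (simp only: ac_simps)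
        also have "\<dots> = emeasure M ?E"
          using False by (simp add: ennreal_one_divide_mult_self)
        finally have "1 / ?m k * emeasure M ?E * ?m k = emeasure M ?E" .
        moreover have "emeasure M {w \<in> space M. (X w, k) \<in> E \<and> Y w = k} \<le> emeasure M ?E"
          by (intro emeasure_mono) auto
        ultimately show ?thesis
          unfolding * by simp
      qed
    qed
    also have "\<dots> = (\<integral>\<^sup>+ p. 1 / ?m (snd p) * indicator E p
        \<partial>(distr M S X \<Otimes>\<^sub>M distr M (count_space T) Y))"
      by (subst nn_integral_product_marginals[OF X Y T]) auto
    also have "\<dots> = emeasure ?D E"
      by (rule emeasure_density[symmetric]) auto
    finally show ?thesis .
  qed
  then show ?thesis
    using sets by (subst le_measure) auto
qed

section \<open>The upper bound on mutual information\<close>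

lemma (in prob_space) mutual_info_le_ln_card:
  assumes X[measurable]: "X \<in> M \<rightarrow>\<^sub>M S" and Y[measurable]: "Y \<in> M \<rightarrow>\<^sub>M count_space T"
    and T: "finite T"
  shows "mutual_info M S (count_space T) X Y \<le> ereal (ln (real (card T)))"
proof -
  define J where "J = joint_law M S (count_space T) X Y"
  define Q where "Q = distr M S X \<Otimes>\<^sub>M distr M (count_space T) Y"
  define g where "g p = 1 / emeasure M {w \<in> space M. Y w = snd p}" for p :: "'b \<times> 'c"
  define f where "f = RN_deriv Q J"
  interpret X: prob_space "distr M S X" by (rule prob_space_distr) fact
  interpret Y: prob_space "distr M (count_space T) Y" by (rule prob_space_distr) fact
  interpret P: pair_prob_space "distr M S X" "distr M (count_space T) Y" ..
  interpret Q: prob_space Q unfolding Q_def by (rule P.prob_space_axioms)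
  interpret J: prob_space J unfolding J_def joint_law_def by (rule prob_space_distr) simp
  have sets_Q: "sets Q = sets (S \<Otimes>\<^sub>M count_space T)"
    unfolding Q_def by (intro sets_pair_measure_cong) auto
  have sets_J: "sets J = sets (S \<Otimes>\<^sub>M count_space T)"
    unfolding J_def joint_law_def by simp
  note [measurable_cong] = sets_Q sets_J
  have gQ[measurable]: "g \<in> borel_measurable (S \<Otimes>\<^sub>M count_space T)"
    unfolding g_def by (rule measurable_compose[OF measurable_snd]) simp
  have fm[measurable]: "f \<in> borel_measurable (S \<Otimes>\<^sub>M count_space T)"
    using borel_measurable_RN_deriv[of Q J] measurable_cong_sets[OF sets_Q refl]
    unfolding f_def by blast
  have J_le: "J \<le> density Q g"
    unfolding J_def Q_def g_def by (rule joint_law_le_density) fact+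
  \<comment> \<open>First of the two conditions without which \<open>mutual_info\<close> is
    infinite; the other is \<open>int_ln\<close>. A \<open>Q\<close>-null set is null for
    \<open>density Q g\<close>, which dominates \<open>J\<close>.\<close>
  have ac: "absolutely_continuous Q J"
  proof -
    have "emeasure J N = 0" if "N \<in> null_sets Q" for N
    proof -
      have "emeasure J N \<le> emeasure (density Q g) N"
        using J_le by (rule le_measureD3) (simp add: sets_J sets_Q)
      moreover have "N \<in> null_sets (density Q g)"
        using that absolutely_continuousI_density[of g Q] by (auto simp: absolutely_continuous_def)
      ultimately show ?thesis by auto
    qed
    then show ?thesis
      by (auto simp: absolutely_continuous_def null_sets_def sets_J sets_Q)
  qed
  have J_eq: "J = density Q f"
    unfolding f_def using ac by (intro Q.density_RN_deriv[symmetric]) (simp_all add: sets_J sets_Q)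

  \<comment> \<open>The domination \<open>J \<le> density Q g\<close> followed by
    \<open>J = density Q f\<close> trades the integral of \<open>f\<close> for that of
    \<open>g\<close>, which is explicit, without comparing \<open>f\<close> and \<open>g\<close>
    pointwise.\<close>
  have "(\<integral>\<^sup>+ p. f p \<partial>J) \<le> (\<integral>\<^sup>+ p. f p \<partial>density Q g)"
    by (rule nn_integral_mono_measure[OF _ J_le]) (simp add: sets_J sets_Q)
  also have "\<dots> = (\<integral>\<^sup>+ p. g p * f p \<partial>Q)"
    by (rule nn_integral_density) simp_all
  also have "\<dots> = (\<integral>\<^sup>+ p. f p * g p \<partial>Q)"
    by (simp add: mult.commute)
  also have "\<dots> = (\<integral>\<^sup>+ p. g p \<partial>J)"
    unfolding J_eq by (rule nn_integral_density[symmetric]) simp_all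
  also have "\<dots> = (\<integral>\<^sup>+ w. 1 / emeasure M {w' \<in> space M. Y w' = Y w} \<partial>M)"
    unfolding J_def joint_law_def by (subst nn_integral_distr) (simp_all add: g_def)
  also have "\<dots> = (\<Sum>k\<in>T. 1 / emeasure M {w \<in> space M. Y w = k} * emeasure M {w \<in> space M. Y w = k})"
    by (rule nn_integral_comp_finite_label[OF Y T])
  also have "\<dots> \<le> (\<Sum>k\<in>T. 1)"
  proof (rule sum_mono)
    fix k
    let ?m = "emeasure M {w \<in> space M. Y w = k}"
    show "1 / ?m * ?m \<le> 1"
      \<comment> \<open>A label of mass zero contributes
        \<open>1 / 0 * 0 = \<infinity> * 0 = 0\<close>, every other label exactly
        \<open>1\<close>.\<close>
      by (cases "?m = 0") (simp_all add: ennreal_one_divide_mult_self)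
  qed
  finally have f_int: "(\<integral>\<^sup>+ p. f p \<partial>J) \<le> ennreal (card T)"
    by (simp add: ennreal_of_nat_eq_real_of_nat)

  \<comment> \<open>A measure does not charge the zero set of its own density.\<close>
  have f_pos: "AE p in J. 0 < f p"
    unfolding J_eq by (subst AE_density) auto
  have f_fin: "AE p in J. f p \<noteq> \<infinity>"
    using f_int by (intro nn_integral_PInf_AE) (auto simp: top_unique)
  define r where "r p = enn2real (f p)" for p
  have rm[measurable]: "r \<in> borel_measurable (S \<Otimes>\<^sub>M count_space T)"
    unfolding r_def by measurable
  have r_pos: "AE p in J. 0 < r p"
    using f_pos f_fin by eventually_elim (auto simp: r_def enn2real_positive_iff less_top)
  have r_int: "(\<integral>\<^sup>+ p. r p \<partial>J) \<le> ennreal (card T)"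
  proof -
    have "(\<integral>\<^sup>+ p. r p \<partial>J) = (\<integral>\<^sup>+ p. f p \<partial>J)"
      using f_fin by (intro nn_integral_cong_AE) (auto simp: r_def less_top)
    with f_int show ?thesis by simp
  qed
  have int_r: "integrable J r"
    using r_int r_pos by (intro integrableI_nonneg) (auto simp: top_unique less_top[symmetric])
  have r_le: "(\<integral>p. r p \<partial>J) \<le> card T"
    using r_int nn_integral_eq_integral[OF int_r] r_pos by (auto simp: eventually_mono)
  have "(\<integral>\<^sup>+ p. ennreal (1 / r p) \<partial>J) = (\<integral>\<^sup>+ p. f p * ennreal (1 / r p) \<partial>Q)"
    unfolding J_eq by (rule nn_integral_density) simp_all
  also have "\<dots> \<le> (\<integral>\<^sup>+ p. 1 \<partial>Q)"
  proof (rule nn_integral_mono)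
    fix p
    \<comment> \<open>The product is \<open>1\<close> where \<open>f p\<close> is positive and
      finite. Elsewhere \<open>r p = 0\<close>, so \<open>1 / r p = 0\<close> by the convention for
      real division and the product vanishes.\<close>
    show "f p * ennreal (1 / r p) \<le> 1"
      by (cases "f p"; cases "r p = 0") (auto simp: r_def ennreal_mult[symmetric])
  qed
  finally have "(\<integral>\<^sup>+ p. ennreal (1 / r p) \<partial>J) \<le> 1"
    by (simp add: Q.emeasure_space_1)
  then have int_inv: "integrable J (\<lambda>p. 1 / r p)"
    by (intro integrableI_nonneg) (auto simp: r_def top_unique less_top[symmetric])
  have ed: "entropy_density (exp 1) Q J = (\<lambda>p. ln (r p))"
    by (auto simp: entropy_density_def r_def f_def log_def)
  have int_ln: "integrable J (\<lambda>p. ln (r p))"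
  proof (rule Bochner_Integration.integrable_bound)
    show "integrable J (\<lambda>p. r p + 1 / r p)"
      using int_r int_inv by simp
    show "AE p in J. norm (ln (r p)) \<le> norm (r p + 1 / r p)"
      using r_pos
    proof eventually_elim
      fix p assume "0 < r p"
      \<comment> \<open>One inequality, \<open>ln t \<le> t - 1\<close>, used at
        \<open>t = r p\<close> for the upper and at \<open>t = 1 / r p\<close> for the lower bound
        on \<open>ln (r p)\<close>.\<close>
      then have "ln (r p) \<le> r p - 1" "ln (1 / r p) \<le> 1 / r p - 1" "0 < 1 / r p"
        by (simp_all add: ln_le_minus_one)
      moreover have "ln (1 / r p) = - ln (r p)"
        using \<open>0 < r p\<close> by (simp add: ln_div)
      ultimately show "norm (ln (r p)) \<le> norm (r p + 1 / r p)"
        using \<open>0 < r p\<close> unfolding real_norm_def by linarith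
    qed
  qed simp
  have cT: "0 < real (card T)"
  proof -
    obtain w where "w \<in> space M" using not_empty by auto
    then have "Y w \<in> T" using measurable_space[OF Y] by simp
    then show ?thesis using T by (auto simp: card_gt_0_iff)
  qed
  \<comment> \<open>The tangent to \<open>ln\<close> is taken at \<open>card T\<close>, the bound on
    the mean of \<open>r\<close> from \<open>r_le\<close>, so that after integration the term
    \<open>- 1\<close> offsets the linear term.\<close>
  have "(\<integral>p. ln (r p) \<partial>J) \<le> (\<integral>p. ln (card T) - 1 + r p / card T \<partial>J)"
  proof (rule integral_mono_AE)
    show "integrable J (\<lambda>p. ln (card T) - 1 + r p / card T)"
      using int_r by simp
    show "AE p in J. ln (r p) \<le> ln (card T) - 1 + r p / card T"
      using r_pos
    proof eventually_elim
      fix p assume "0 < r p"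
      then have "ln (r p / card T) \<le> r p / card T - 1"
        using cT by (intro ln_le_minus_one) simp
      then show "ln (r p) \<le> ln (card T) - 1 + r p / card T"
        using cT \<open>0 < r p\<close> by (simp add: ln_div)
    qed
  qed fact
  also have "\<dots> = ln (card T) - 1 + (\<integral>p. r p \<partial>J) / card T"
    using int_r by (simp add: J.prob_space)
  also have "\<dots> \<le> ln (card T)"
    using r_le cT by (simp add: field_simps)
  finally have "prob_space.mutual_information M (exp 1) S (count_space T) X Y \<le> ln (card T)"
    using ed by (simp add: mutual_information_def KL_divergence_def J_def Q_def joint_law_def)
  then show ?thesis
    using ac int_ln ed by (simp add: mutual_info_def J_def Q_def Let_def)
qed

section \<open>Uniform labels: entropy and attainment of the bound\<close>

lemma (in prob_space) entropy_uniform_label: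
  assumes Y: "Y \<in> M \<rightarrow>\<^sub>M count_space T" and T: "finite T"
    and u: "\<And>k. k \<in> T \<Longrightarrow> prob {w \<in> space M. Y w = k} = 1 / card T"
  shows "shannon_entropy M (count_space T) Y = ln (card T)"
proof -
  interpret information_space M "exp 1" by standard simp
  obtain w where "w \<in> space M" using not_empty by auto
  then have "T \<noteq> {}" using measurable_space[OF Y] by auto
  \<comment> \<open>With respect to counting measure the mass function is the density, and measures
    on a finite set are compared on singletons.\<close>
  have "distributed M (count_space T) Y (\<lambda>k. ennreal (1 / card T))"
    unfolding distributed_def
  proof (intro conjI Y)
    show "distr M (count_space T) Y = density (count_space T) (\<lambda>k. ennreal (1 / card T))"
    proof (rule measure_eqI_finite[OF _ _ T])
      fix k assume "k \<in> T"
      then have "emeasure (distr M (count_space T) Y) {k} = ennreal (1 / card T)"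
        using u[of k] Y
        by (simp add: emeasure_distr emeasure_eq_measure vimage_def Int_def conj_commute)
      moreover have "emeasure (density (count_space T) (\<lambda>k. ennreal (1 / card T))) {k}
          = ennreal (1 / card T)"
        using \<open>k \<in> T\<close> by (simp add: emeasure_density_const)
      ultimately show "emeasure (distr M (count_space T) Y) {k}
          = emeasure (density (count_space T) (\<lambda>k. ennreal (1 / card T))) {k}"
        by simp
    qed auto
  qed simp
  then have "entropy (exp 1) (count_space T) Y = - (\<integral>k. 1 / card T * log (exp 1) (1 / card T) \<partial>count_space T)"
    by (rule entropy_distr) simp
  then show ?thesis
    using T \<open>T \<noteq> {}\<close> by (simp add: shannon_entropy_def lebesgue_integral_count_space_finite log_def ln_div)
qed

lemma (in prob_space) mutual_info_uniform_function:
  assumes X[measurable]: "X \<in> M \<rightarrow>\<^sub>M S" and Y[measurable]: "Y \<in> M \<rightarrow>\<^sub>M count_space T"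
    and T: "finite T"
    and u: "\<And>k. k \<in> T \<Longrightarrow> prob {w \<in> space M. Y w = k} = 1 / card T"
    and A[measurable]: "\<And>k. k \<in> T \<Longrightarrow> A k \<in> sets S"
    and YA: "\<And>w k. w \<in> space M \<Longrightarrow> k \<in> T \<Longrightarrow> Y w = k \<longleftrightarrow> X w \<in> A k"
  shows "mutual_info M S (count_space T) X Y = ereal (ln (card T))"
proof -
  define J where "J = joint_law M S (count_space T) X Y"
  define Q where "Q = distr M S X \<Otimes>\<^sub>M distr M (count_space T) Y"
  \<comment> \<open>Graph of the label as a function of \<open>X\<close>: by \<open>YA\<close>,
    \<open>(X w, k)\<close> lies in \<open>G\<close> exactly when \<open>Y w = k\<close>. As a
    finite union of rectangles it is measurable.\<close>
  define G where "G = (\<Union>k\<in>T. A k \<times> {k})"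
  define h :: "'b \<times> 'c \<Rightarrow> ennreal" where "h p = of_nat (card T) * indicator G p" for p
  interpret X: prob_space "distr M S X" by (rule prob_space_distr) fact
  interpret Y: prob_space "distr M (count_space T) Y" by (rule prob_space_distr) fact
  interpret P: pair_prob_space "distr M S X" "distr M (count_space T) Y" ..
  interpret Q: prob_space Q unfolding Q_def by (rule P.prob_space_axioms)
  interpret J: prob_space J unfolding J_def joint_law_def by (rule prob_space_distr) simp
  have sets_Q: "sets Q = sets (S \<Otimes>\<^sub>M count_space T)"
    unfolding Q_def by (intro sets_pair_measure_cong) auto
  have sets_J: "sets J = sets (S \<Otimes>\<^sub>M count_space T)"
    unfolding J_def joint_law_def by simp
  note [measurable_cong] = sets_Q sets_J
  have G[measurable]: "G \<in> sets (S \<Otimes>\<^sub>M count_space T)"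
    unfolding G_def using T by (intro sets.finite_UN pair_measureI) auto
  have hm[measurable]: "h \<in> borel_measurable (S \<Otimes>\<^sub>M count_space T)"
    unfolding h_def by measurable
  have cT: "0 < card T"
  proof -
    obtain w where "w \<in> space M" using not_empty by auto
    then have "Y w \<in> T" using measurable_space[OF Y] by simp
    then show ?thesis using T by (auto simp: card_gt_0_iff)
  qed
  have J_eq: "density Q h = J"
  proof (rule measure_eqI)
    fix E assume "E \<in> sets (density Q h)"
    then have E[measurable]: "E \<in> sets (S \<Otimes>\<^sub>M count_space T)"
      by (simp add: sets_Q)
    have "emeasure (density Q h) E = (\<integral>\<^sup>+ p. h p * indicator E p \<partial>Q)"
      by (rule emeasure_density) simp_all
    also have "\<dots> = (\<Sum>k\<in>T. (\<integral>\<^sup>+ w. h (X w, k) * indicator E (X w, k) \<partial>M)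
        * emeasure M {w \<in> space M. Y w = k})"
      unfolding Q_def by (rule nn_integral_product_marginals[OF X Y T]) simp
    \<comment> \<open>The indicator of \<open>G\<close> inside \<open>h\<close> enforces
      \<open>Y w = k\<close>, and the factor \<open>card T\<close> cancels the uniform mass of the
      label.\<close>
    also have "\<dots> = (\<Sum>k\<in>T. emeasure M {w \<in> space M. (X w, k) \<in> E \<and> Y w = k})"
    proof (rule sum.cong[OF refl])
      fix k assume k: "k \<in> T"
      let ?E = "{w \<in> space M. (X w, k) \<in> E \<and> Y w = k}"
      have [measurable]: "?E \<in> sets M" using k by simp
      have "(\<integral>\<^sup>+ w. h (X w, k) * indicator E (X w, k) \<partial>M)
          = (\<integral>\<^sup>+ w. of_nat (card T) * indicator ?E w \<partial>M)"
        using k YA by (intro nn_integral_cong) (auto simp: h_def G_def indicator_def)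
      also have "\<dots> = of_nat (card T) * emeasure M ?E"
        by (simp add: nn_integral_cmult)
      finally show "(\<integral>\<^sup>+ w. h (X w, k) * indicator E (X w, k) \<partial>M)
          * emeasure M {w \<in> space M. Y w = k} = emeasure M ?E"
        using u[OF k] cT
        by (simp add: emeasure_eq_measure ennreal_of_nat_eq_real_of_nat ennreal_mult[symmetric])
    qed
    also have "\<dots> = emeasure J E"
      unfolding J_def by (rule emeasure_joint_law[OF X Y T E, symmetric])
    finally show "emeasure (density Q h) E = emeasure J E" .
  qed (simp add: sets_J sets_Q)
  have ac: "absolutely_continuous Q J"
    unfolding J_eq[symmetric] by (rule absolutely_continuousI_density) simp
  have "AE p in Q. h p = RN_deriv Q J p"
    by (rule Q.RN_deriv_unique[OF _ J_eq]) simp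
  \<comment> \<open>Uniqueness of the density holds only up to \<open>Q\<close>-null sets; absolute
    continuity carries it over to \<open>J\<close>. There \<open>h\<close> is also positive, which
    excludes its value \<open>0\<close> off \<open>G\<close> and leaves
    \<open>card T\<close>.\<close>
  then have "AE p in J. h p = RN_deriv Q J p"
    using ac sets_J sets_Q by (intro absolutely_continuous_AE[of J Q]) auto
  moreover have "AE p in J. 0 < h p"
    unfolding J_eq[symmetric] by (subst AE_density) auto
  ultimately have ed: "AE p in J. entropy_density (exp 1) Q J p = ln (card T)"
  proof eventually_elim
    fix p assume "h p = RN_deriv Q J p" "0 < h p"
    then have "RN_deriv Q J p = of_nat (card T)"
      by (cases "p \<in> G") (auto simp: h_def)
    then show "entropy_density (exp 1) Q J p = ln (card T)"
      by (simp add: entropy_density_def log_def)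
  qed
  have edm[measurable]: "entropy_density (exp 1) Q J \<in> borel_measurable J"
    using measurable_entropy_density[of "exp 1" Q J] measurable_cong_sets[of Q J] sets_J sets_Q by blast
  have "integrable J (entropy_density (exp 1) Q J)"
    using integrable_cong_AE[THEN iffD2, OF _ _ ed] by simp
  moreover have "(\<integral>p. entropy_density (exp 1) Q J p \<partial>J) = ln (card T)"
    using integral_cong_AE[OF _ _ ed] by (simp add: J.prob_space)
  then have "prob_space.mutual_information M (exp 1) S (count_space T) X Y = ln (card T)"
    by (simp add: mutual_information_def KL_divergence_def J_def Q_def joint_law_def)
  ultimately show ?thesis
    using ac by (simp add: mutual_info_def J_def Q_def Let_def)
qed

section \<open>The Gaussian vector with equiprobable cells\<close>

theorem proposition1:
  fixes M :: "'w measure"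
    and z :: "'w \<Rightarrow> real ^ 'n::finite"
    and A :: "nat \<Rightarrow> (real ^ 'n) set"
    and y :: "'w \<Rightarrow> nat"
    and K :: nat
    and q :: "(real ^ 'n) measure"
  assumes "prob_space M"
    and "K \<ge> 1"
    and "z \<in> M \<rightarrow>\<^sub>M borel"
    and "distr M borel z = std_gaussian"
    and "\<And>k. k \<in> {1..K} \<Longrightarrow> A k \<in> sets borel"
    and "disjoint_family_on A {1..K}"
    and "(\<Union>k\<in>{1..K}. A k) = UNIV"
    and "\<And>k. k \<in> {1..K} \<Longrightarrow> measure M {w \<in> space M. z w \<in> A k} = 1 / real K"
    and "y \<in> space M \<rightarrow> {1..K}"
    and "\<And>w k. w \<in> space M \<Longrightarrow> k \<in> {1..K} \<Longrightarrow> y w = k \<longleftrightarrow> z w \<in> A k"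
  defines "q \<equiv> distr (joint_law M borel (count_space {1..K}) z y) borel fst"
  shows "q = std_gaussian
    \<and> (\<forall>D. divergence D \<longrightarrow> D q std_gaussian = 0)
    \<and> mutual_info M borel (count_space {1..K}) z y
        = ereal (shannon_entropy M (count_space {1..K}) y)
    \<and> shannon_entropy M (count_space {1..K}) y = ln (real K)
    \<and> (\<forall>(N :: 'v measure) (S :: 'x measure) X Y.
          prob_space N \<longrightarrow> X \<in> N \<rightarrow>\<^sub>M S \<longrightarrow> Y \<in> N \<rightarrow>\<^sub>M count_space {1..K} \<longrightarrow>
          mutual_info N S (count_space {1..K}) X Y \<le> ereal (ln (real K)))"
proof -
  interpret prob_space M by fact
  note z[measurable] = assms(3) and A[measurable] = assms(5)
  \<comment> \<open>Measurability of the label is inherited from the cells: the event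
    \<open>y = k\<close> is the preimage of \<open>A k\<close> under \<open>z\<close>.\<close>
  have y[measurable]: "y \<in> M \<rightarrow>\<^sub>M count_space {1..K}"
  proof (subst measurable_count_space_eq2, simp, intro conjI ballI assms(9))
    fix k assume k: "k \<in> {1..K}"
    then have "y -` {k} \<inter> space M = z -` A k \<inter> space M"
      using assms(10) by auto
    then show "y -` {k} \<inter> space M \<in> sets M"
      using measurable_sets[OF z A[OF k]] by simp
  qed
  have unif: "prob {w \<in> space M. y w = k} = 1 / card {1..K}" if "k \<in> {1..K}" for k
  proof -
    have "{w \<in> space M. y w = k} = {w \<in> space M. z w \<in> A k}"
      using assms(10) that by auto
    then show ?thesis using assms(8)[OF that] by simp
  qed
  \<comment> \<open>Projecting the joint law to its first coordinate returns the law of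
    \<open>z\<close>, whatever the label.\<close>
  have q: "q = std_gaussian"
    unfolding q_def joint_law_def
    by (subst distr_distr[OF measurable_fst measurable_Pair[OF z y]]) (simp add: comp_def assms(4))
  \<comment> \<open>A divergence vanishes on equal arguments only for probability measures. That the
    Gaussian density has total mass one follows from its being the law of \<open>z\<close>, with no
    integral computed.\<close>
  have "prob_space (std_gaussian :: (real ^ 'n) measure)"
    unfolding assms(4)[symmetric] by (rule prob_space_distr) simp
  then have div: "D q std_gaussian = 0" if "divergence D" for D
    using that unfolding divergence_def q by (simp add: std_gaussian_def)
  \<comment> \<open>The bound for arbitrary pairs, together with its attainment by \<open>z\<close>
    and \<open>y\<close>, makes \<open>ln K\<close> a maximum.\<close>
  show ?thesis
    using q div entropy_uniform_label[OF y _ unif]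
      mutual_info_uniform_function[OF z y _ unif A assms(10)]
      prob_space.mutual_info_le_ln_card[where T = "{1..K}"]
    by auto
qed

end
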